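(* Let $\lambda$ be a nonzero real number. For every integer $n \geq 0$, \[ b_{n+1,\lambda}(x)-x\,b_{n,\lambda}(x-\lambda)+b_{n,\lambda}(x-\lambda)=2\sum_{k=0}^n\sum_{m=0}^k\sum_{l=0}^m\binom{n}{k}\binom{m}{l}\lambda^{k-m+l}S_1(k,m)\,b_{n-k,\lambda}\,(-1)^l\,b_{m-l}(x). \]
   Context: For a nonzero real $\lambda$, the degenerate ordered Bell polynomials $b_{n,\lambda}(x)$ are defined by the formal power series identity \[ \frac{1}{2-(1+\lambda t)^{1/\lambda}}(1+\lambda t)^{x/\lambda}=\sum_{n=0}^\infty b_{n,\lambda}(x)\frac{t^n}{n!}, \] where $(1+\lambda t)^{a/\lambda}=\exp\big(\tfrac{a}{\lambda}\log(1+\lambda t)\big)$, and $b_{n,\lambda}=b_{n,\lambda}(0)$. The ordered Bell polynomials $b_n(x)$ are defined by $\frac{1}{2-e^t}e^{xt}=\sum_{n\ge 0}b_n(x)\frac{t^n}{n!}$. The (signed) Stirling numbers of the first kind $S_1(n,l)$ are defined by $x(x-1)\cdots(x-n+1)=\sum_{l=0}^n S_1(n,l)x^l$. *)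

theory Defs
  imports "HOL-Computational_Algebra.Computational_Algebra"
begin

(* The formal power series (1 + lam t) powr (a / lam), i.e. exp ((a / lam) * log (1 + lam t)).
   Here fps_ln 1 is the series log (1 + t) and fps_exp 1 is exp t; both inner series of the
   compositions have constant term 0. *)
definition degenerate_exp :: "real \<Rightarrow> real \<Rightarrow> real fps" where
  "degenerate_exp lam a =
     fps_exp 1 oo (fps_const (a / lam) * (fps_ln 1 oo (fps_const lam * fps_X)))"

definition degenerate_ordered_bell :: "real \<Rightarrow> nat \<Rightarrow> real \<Rightarrow> real" where
  "degenerate_ordered_bell lam n x =
     fact n * fps_nth (1 / (2 - degenerate_exp lam 1) * degenerate_exp lam x) n"

definition ordered_bell :: "nat \<Rightarrow> real \<Rightarrow> real" where
  "ordered_bell n x = fact n * fps_nth (1 / (2 - fps_exp 1) * fps_exp x) n"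

(* The library constant stirling denotes the unsigned numbers of the first kind;
   these are the signed ones. *)
definition stirling_first :: "nat \<Rightarrow> nat \<Rightarrow> real" where
  "stirling_first n l = coeff (\<Prod>i<n. [:- of_nat i, 1:]) l"

lemma degenerate_ordered_bell_gf:
  "1 / (2 - degenerate_exp lam 1) * degenerate_exp lam x =
     Abs_fps (\<lambda>n. degenerate_ordered_bell lam n x / fact n)"
  by (simp add: fps_eq_iff degenerate_ordered_bell_def)

lemma ordered_bell_gf:
  "1 / (2 - fps_exp 1) * fps_exp x = Abs_fps (\<lambda>n. ordered_bell n x / fact n)"
  by (simp add: fps_eq_iff ordered_bell_def)

lemma stirling_first_falling_factorial:
  "(\<Prod>i<n. x - real i) = (\<Sum>l\<le>n. stirling_first n l * x ^ l)"
proof -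
  let ?p = "\<Prod>i<n. [:- real i, 1:]"
  have "degree ?p = n"
    by (subst degree_prod_eq_sum_degree) auto
  then have "poly ?p x = (\<Sum>l\<le>n. stirling_first n l * x ^ l)"
    by (simp add: poly_altdef stirling_first_def)
  then show ?thesis
    by (simp add: poly_prod)
qed

(* The divisions in the two generating functions are by units, hence genuine quotients. *)
lemma degenerate_exp_denominator_nth_0: "fps_nth (2 - degenerate_exp lam a) 0 = 1"
  by (simp add: degenerate_exp_def fps_compose_nth numeral_fps_const)

lemma ordered_bell_denominator_nth_0: "fps_nth (2 - fps_exp (1 :: real)) 0 = 1"
  by (simp add: numeral_fps_const)

end

theory Submission
  imports Defs
begin

text \<open>
  Put \<open>L = log (1 + \<lambda>t) / \<lambda>\<close>, so that \<open>(1 + \<lambda>t)\<^bsup>a/\<lambda>\<^esup> = exp (aL)\<close> and the degenerate generating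
  function is \<open>B\<^sub>x(L)\<close>, where \<open>B\<^sub>x(t) = exp (xt) / (2 - exp t)\<close> generates the ordered Bell
  polynomials. Differentiation gives \<open>B\<^sub>x' + (1 - x) B\<^sub>x = 2 B\<^sub>0 B\<^sub>x\<close>. Multiplying by \<open>exp (-\<lambda>t)\<close>,
  substituting \<open>L\<close> for \<open>t\<close> and using \<open>L' = exp (-\<lambda>L)\<close>, one obtains the left-hand side of the theorem
  as the coefficients of \<open>2 B\<^sub>0(L) B\<^bsub>x-\<lambda>\<^esub>(L)\<close>. The inner double sum on the right-hand side arises by
  expanding \<open>B\<^bsub>x-\<lambda>\<^esub>(t) = exp (-\<lambda>t) B\<^sub>x(t)\<close> and converting coefficients of \<open>P\<close> into coefficients of
  \<open>P(L)\<close> by means of the Stirling numbers of the first kind.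
\<close>

definition degenerate_log :: "real \<Rightarrow> real fps" where
  "degenerate_log lam = fps_const (1 / lam) * (fps_ln 1 oo (fps_const lam * fps_X))"

definition ordered_bell_fps :: "real \<Rightarrow> real fps" where
  "ordered_bell_fps x = inverse (2 - fps_exp 1) * fps_exp x"

lemma degenerate_log_nth_0 [simp]: "degenerate_log lam $ 0 = 0"
  by (simp add: degenerate_log_def)

text \<open>The scalar \<open>a\<close> moves from the inner series to the outer one, so all
  exponents share the inner series \<open>degenerate_log lam\<close>.\<close>

lemma degenerate_exp_eq_compose: "degenerate_exp lam a = fps_exp a oo degenerate_log lam"
proof -
  let ?M = "fps_ln 1 oo (fps_const lam * fps_X)"
  have "fps_const (a / lam) * ?M = (fps_const a * fps_X) oo degenerate_log lam"
    by (simp add: degenerate_log_def fps_compose_mult_distrib flip: mult.assoc)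
  then have "degenerate_exp lam a = fps_exp 1 oo (fps_const a * fps_X) oo degenerate_log lam"
    unfolding degenerate_exp_def by (simp add: fps_compose_assoc)
  then show ?thesis by simp
qed

lemma degenerate_exp_self:
  assumes "lam \<noteq> 0"
  shows "degenerate_exp lam lam = 1 + fps_const lam * fps_X"
proof -
  \<comment> \<open>Compositional inversion needs constant term 0, hence
    \<open>fps_exp 1 - 1\<close>.\<close>
  have "(fps_exp 1 - 1) oo fps_ln (1 :: real) = fps_X"
    by (simp add: fps_ln_fps_exp_inv fps_inv_fps_exp_compose)
  then have "fps_exp 1 oo fps_ln (1 :: real) = 1 + fps_X"
    by (simp add: fps_compose_sub_distrib algebra_simps)
  moreover have "degenerate_exp lam lam = fps_exp 1 oo fps_ln 1 oo (fps_const lam * fps_X)"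
    using assms by (simp add: degenerate_exp_def fps_compose_assoc)
  ultimately show ?thesis
    by (simp add: fps_compose_add_distrib)
qed

text \<open>Differentiate exp(\<lambda>L) = 1 + \<lambda>t by the chain rule and cancel
  \<lambda>.\<close>

lemma degenerate_log_deriv:
  assumes "lam \<noteq> 0"
  shows "(1 + fps_const lam * fps_X) * fps_deriv (degenerate_log lam) = 1"
proof -
  have "fps_const lam = fps_deriv (degenerate_exp lam lam)"
    by (simp add: degenerate_exp_self[OF assms])
  also have "\<dots> = fps_const lam * (degenerate_exp lam lam * fps_deriv (degenerate_log lam))"
    by (simp add: degenerate_exp_eq_compose fps_compose_deriv fps_compose_mult_distrib mult.assoc)
  finally have "fps_const lam * ((1 + fps_const lam * fps_X) * fps_deriv (degenerate_log lam))
      = fps_const lam * 1"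
    by (simp add: degenerate_exp_self[OF assms])
  then show ?thesis
    using assms by (metis fps_const_eq_0_iff mult_cancel_left)
qed

text \<open>Both sides are multiplicative inverses of 1 + \<lambda>t = exp(\<lambda>L).\<close>

lemma degenerate_log_deriv_eq_exp:
  assumes "lam \<noteq> 0"
  shows "fps_deriv (degenerate_log lam) = fps_exp (- lam) oo degenerate_log lam"
proof -
  let ?L = "degenerate_log lam"
  have "(fps_exp lam oo ?L) * (fps_exp (- lam) oo ?L) = 1"
    by (simp add: fps_compose_mult_distrib[symmetric] fps_exp_add_mult[symmetric])
  then have inv: "(1 + fps_const lam * fps_X) * (fps_exp (- lam) oo ?L) = 1"
    using degenerate_exp_self[OF assms] by (simp add: degenerate_exp_eq_compose)
  then show ?thesis
    using degenerate_log_deriv[OF assms]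
    by (metis mult_cancel_left mult_zero_left zero_neq_one)
qed

lemma ordered_bell_eq_nth: "ordered_bell n x = fact n * ordered_bell_fps x $ n"
  by (simp add: ordered_bell_def ordered_bell_fps_def fps_divide_unit numeral_fps_const)

text \<open>Inversion commutes with composition here: 2 - exp t has constant term 1 and L has
  constant term 0.\<close>

lemma degenerate_ordered_bell_eq_nth:
  "degenerate_ordered_bell lam n x = fact n * (ordered_bell_fps x oo degenerate_log lam) $ n"
  using degenerate_exp_denominator_nth_0[of lam 1]
  by (simp add: degenerate_ordered_bell_def ordered_bell_fps_def degenerate_exp_eq_compose
      fps_divide_unit fps_compose_mult_distrib fps_inverse_compose fps_compose_sub_distrib
      ordered_bell_denominator_nth_0)

lemma exp_mult_ordered_bell_fps: "fps_exp a * ordered_bell_fps x = ordered_bell_fps (x + a)"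
  by (simp add: ordered_bell_fps_def fps_exp_add_mult algebra_simps)

lemma ordered_bell_fps_deriv:
  "fps_deriv (ordered_bell_fps x) + fps_const (1 - x) * ordered_bell_fps x
    = 2 * (ordered_bell_fps 0 * ordered_bell_fps x)"
proof -
  define D :: "real fps" where "D = 2 - fps_exp 1"
  have D0: "D $ 0 \<noteq> 0"
    by (simp add: D_def numeral_fps_const)
  have "fps_deriv D = - fps_exp 1"
    by (simp add: D_def numeral_fps_const)
  \<comment> \<open>Writing D' through D itself gives (1/D)' = 2/D^2 - 1/D, the source of the
    product on the right-hand side.\<close>
  then have D': "fps_deriv D = D - 2"
    by (simp add: D_def)
  have inv: "inverse D * D = 1"
    using D0 by (rule inverse_mult_eq_1)
  have "fps_deriv (inverse D) = - fps_deriv D * (inverse D)\<^sup>2"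
    using D0 by (rule fps_inverse_deriv)
  also have "\<dots> = 2 * inverse D * inverse D - inverse D * (inverse D * D)"
    by (simp add: D' power2_eq_square algebra_simps)
  finally have inv': "fps_deriv (inverse D) = 2 * inverse D * inverse D - inverse D"
    by (simp add: inv)
  have B: "ordered_bell_fps y = inverse D * fps_exp y" for y
    by (simp add: ordered_bell_fps_def D_def)
  show ?thesis
    by (simp add: B inv' algebra_simps flip: fps_const_sub)
qed

lemma stirling_first_eq_0: "n < l \<Longrightarrow> stirling_first n l = 0"
  unfolding stirling_first_def
  by (rule coeff_eq_0, subst degree_prod_eq_sum_degree) auto

lemma stirling_first_0 [simp]: "stirling_first 0 l = (if l = 0 then 1 else 0)"
  by (simp add: stirling_first_def)

lemma stirling_first_Suc_0: "stirling_first (Suc n) 0 = - real n * stirling_first n 0"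
  by (simp add: stirling_first_def coeff_mult_0 mult.commute)

lemma stirling_first_Suc_Suc:
  "stirling_first (Suc n) (Suc l) = stirling_first n l - real n * stirling_first n (Suc l)"
  by (simp add: stirling_first_def mult.commute[of _ "[:_, _:]"])

text \<open>Compares coefficients in (1 + \<lambda>t) Q' = P'(L) for Q = P(L). The resulting
  recursion has the shape of the Stirling recurrence.\<close>

lemma compose_degenerate_log_nth_Suc:
  assumes "lam \<noteq> 0"
  shows "fact (Suc n) * (P oo degenerate_log lam) $ Suc n
    = fact n * (fps_deriv P oo degenerate_log lam) $ n
      - real n * lam * (fact n * (P oo degenerate_log lam) $ n)"
proof -
  define Q where "Q = P oo degenerate_log lam"
  have "(1 + fps_const lam * fps_X) * fps_deriv Q
      = (fps_deriv P oo degenerate_log lam)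
        * ((1 + fps_const lam * fps_X) * fps_deriv (degenerate_log lam))"
    by (simp add: Q_def fps_compose_deriv mult_ac)
  also have "\<dots> = fps_deriv P oo degenerate_log lam"
    by (simp add: degenerate_log_deriv[OF assms])
  finally have "fps_deriv P oo degenerate_log lam
      = fps_deriv Q + fps_const lam * (fps_X * fps_deriv Q)"
    by (simp add: algebra_simps)
  then have "(fps_deriv P oo degenerate_log lam) $ n = real (Suc n) * Q $ Suc n + lam * real n * Q $ n"
    by (cases n) simp_all
  then show ?thesis
    unfolding Q_def[symmetric] by (simp add: algebra_simps)
qed

lemma compose_degenerate_log_nth:
  assumes "lam \<noteq> 0"
  shows "fact n * (P oo degenerate_log lam) $ n
    = (\<Sum>m\<le>n. lam ^ (n - m) * stirling_first n m * (fact m * P $ m))"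
\<comment> \<open>\<open>P\<close> must vary, since the recursion also calls for the derivative of
  \<open>P\<close>.\<close>
proof (induction n arbitrary: P)
  case 0
  then show ?case by (simp add: fps_compose_nth)
next
  case (Suc n)
  let ?T = "\<lambda>n m. lam ^ (n - m) * stirling_first n m"
  let ?p = "\<lambda>m. fact m * P $ m"
  have T_Suc: "?T (Suc n) (Suc m) = ?T n m - real n * lam * ?T n (Suc m)" if "m \<le> n" for m
  \<comment> \<open>For \<open>m = n\<close> the exponent \<open>n - Suc m\<close> is truncated to
    0, but its coefficient \<open>stirling_first n (Suc n)\<close> vanishes.\<close>
  proof (cases "m = n")
    case True
    then show ?thesis by (simp add: stirling_first_Suc_Suc stirling_first_eq_0)
  next
    case False
    with that have "lam ^ (n - m) = lam * lam ^ (n - Suc m)"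
      by (metis Suc_diff_Suc le_neq_implies_less power_Suc)
    then show ?thesis by (simp add: stirling_first_Suc_Suc algebra_simps)
  qed
  have "(\<Sum>m\<le>Suc n. ?T (Suc n) m * ?p m)
      = ?T (Suc n) 0 * ?p 0 + (\<Sum>m\<le>n. ?T (Suc n) (Suc m) * ?p (Suc m))"
    by (rule sum.atMost_Suc_shift)
  also have "(\<Sum>m\<le>n. ?T (Suc n) (Suc m) * ?p (Suc m))
      = (\<Sum>m\<le>n. ?T n m * ?p (Suc m) - real n * lam * (?T n (Suc m) * ?p (Suc m)))"
    by (intro sum.cong refl) (simp only: T_Suc atMost_iff left_diff_distrib mult.assoc)
  also have "\<dots> = (\<Sum>m\<le>n. ?T n m * ?p (Suc m))
      - real n * lam * (\<Sum>m\<le>n. ?T n (Suc m) * ?p (Suc m))"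
    by (simp only: sum_subtractf sum_distrib_left)
  also have "?T (Suc n) 0 * ?p 0 = - real n * lam * (?T n 0 * ?p 0)"
    by (simp add: stirling_first_Suc_0)
  also have "- real n * lam * (?T n 0 * ?p 0) + ((\<Sum>m\<le>n. ?T n m * ?p (Suc m))
        - real n * lam * (\<Sum>m\<le>n. ?T n (Suc m) * ?p (Suc m)))
      = (\<Sum>m\<le>n. ?T n m * ?p (Suc m)) - real n * lam * (\<Sum>m\<le>Suc n. ?T n m * ?p m)"
    unfolding sum.atMost_Suc_shift[of _ n] by (simp only: algebra_simps mult_minus_left mult_minus_right)
  also have "(\<Sum>m\<le>Suc n. ?T n m * ?p m) = (\<Sum>m\<le>n. ?T n m * ?p m)"
    by (simp add: stirling_first_eq_0)
  also have "\<dots> = fact n * (P oo degenerate_log lam) $ n"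
    by (rule Suc.IH[symmetric])
  \<comment> \<open>Differentiation shifts the scaled coefficients:
    \<open>fact m * fps_deriv P $ m = ?p (Suc m)\<close>.\<close>
  also have "(\<Sum>m\<le>n. ?T n m * ?p (Suc m)) = fact n * (fps_deriv P oo degenerate_log lam) $ n"
    by (simp add: Suc.IH algebra_simps)
  finally show ?case
    by (simp only: compose_degenerate_log_nth_Suc[OF assms])
qed

text \<open>Products of exponential generating functions are binomial convolutions.\<close>

lemma fact_fps_mult_nth:
  fixes f g :: "real fps"
  shows "fact n * (f * g) $ n = (\<Sum>k\<le>n. real (n choose k) * (fact k * f $ k) * (fact (n - k) * g $ (n - k)))"
  by (simp add: fps_mult_nth atMost_atLeast0 sum_distrib_left binomial_fact)

lemma ordered_bell_shift:
  "ordered_bell m (x + a) = (\<Sum>l\<le>m. real (m choose l) * a ^ l * ordered_bell (m - l) x)"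
  unfolding ordered_bell_eq_nth exp_mult_ordered_bell_fps[symmetric] fact_fps_mult_nth
  by simp

lemma degenerate_ordered_bell_recurrence:
  assumes "lam \<noteq> 0"
  shows "degenerate_ordered_bell lam (Suc n) x
           - x * degenerate_ordered_bell lam n (x - lam)
           + degenerate_ordered_bell lam n (x - lam)
         = 2 * (\<Sum>k\<le>n. real (n choose k) * degenerate_ordered_bell lam k (x - lam)
             * degenerate_ordered_bell lam (n - k) 0)"
proof -
  let ?L = "degenerate_log lam"
  let ?F = "\<lambda>y. ordered_bell_fps y oo ?L"
  have shift: "(fps_exp (- lam) oo ?L) * ?F x = ?F (x - lam)"
    by (simp add: fps_compose_mult_distrib[symmetric] exp_mult_ordered_bell_fps)
  \<comment> \<open>The common factor exp(-\<lambda>L) is L' from the chain rule in the first term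
    and the shift from \<open>x\<close> to \<open>x - lam\<close> in the second.\<close>
  have "fps_deriv (?F x) + fps_const (1 - x) * ?F (x - lam)
      = (fps_exp (- lam) oo ?L)
        * ((fps_deriv (ordered_bell_fps x) + fps_const (1 - x) * ordered_bell_fps x) oo ?L)"
    by (simp add: fps_compose_deriv degenerate_log_deriv_eq_exp[OF assms] shift[symmetric]
        fps_compose_add_distrib fps_compose_mult_distrib algebra_simps)
  also have "\<dots> = fps_const 2 * (?F (x - lam) * ?F 0)"
    unfolding ordered_bell_fps_deriv
    by (simp add: fps_compose_mult_distrib shift[symmetric] mult_ac numeral_fps_const)
  finally have "fact n * (fps_deriv (?F x) + fps_const (1 - x) * ?F (x - lam)) $ n
      = 2 * (fact n * (?F (x - lam) * ?F 0) $ n)"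
    by simp
  then show ?thesis
    unfolding fact_fps_mult_nth degenerate_ordered_bell_eq_nth
    by (simp add: algebra_simps)
qed

theorem theorem7:
  fixes lam x :: real and n :: nat
  assumes "lam \<noteq> 0"
  shows "degenerate_ordered_bell lam (n + 1) x
           - x * degenerate_ordered_bell lam n (x - lam)
           + degenerate_ordered_bell lam n (x - lam)
         = 2 * (\<Sum>k=0..n. \<Sum>m=0..k. \<Sum>l=0..m.
             real (n choose k) * real (m choose l) * lam ^ (k - m + l) * stirling_first k m
             * degenerate_ordered_bell lam (n - k) 0 * (- 1) ^ l * ordered_bell (m - l) x)"
proof -
  \<comment> \<open>The form \<open>x + - lam\<close> lets \<open>ordered_bell_shift\<close> apply
    with \<open>a = - lam\<close>, whose powers supply the signs (-1)^l.\<close>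
  have "degenerate_ordered_bell lam k (x - lam)
      = (\<Sum>m\<le>k. lam ^ (k - m) * stirling_first k m * ordered_bell m (x + - lam))" for k
    by (simp add: degenerate_ordered_bell_eq_nth compose_degenerate_log_nth[OF assms]
        ordered_bell_eq_nth)
  then have expand: "degenerate_ordered_bell lam k (x - lam)
      = (\<Sum>m\<le>k. \<Sum>l\<le>m. real (m choose l) * lam ^ (k - m + l) * stirling_first k m
          * (- 1) ^ l * ordered_bell (m - l) x)" for k
    by (simp only: ordered_bell_shift power_minus[of lam] sum_distrib_left power_add mult_ac)
  show ?thesis
    using degenerate_ordered_bell_recurrence[OF assms, of n x]
    by (simp only: expand sum_distrib_left sum_distrib_right atMost_atLeast0 mult_ac Suc_eq_plus1)
qed

end
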